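(* Let $s$ be a positive integer and $n_1,\dots,n_s,k$ nonnegative integers with $N:=n_1+\cdots+n_s>sk$. If $k>0$, then $$\sum_{l=0}^{N-sk}\binom{N-sk}{l}(-1)^l\xi_{l+sk,q}=q^2\sum_{l=0}^{sk}\binom{sk}{l}(-1)^{sk-l}\xi_{N-l,1/q}.$$ Moreover (case $k=0$, i.e. $N>0$), $$\sum_{l=0}^{N}\binom{N}{l}(-1)^l\xi_{l,q}=[2]_q+q^2\xi_{N,1/q}.$$
   Context: Let $p$ be an odd prime, $\mathbb{C}_p$ the completion of an algebraic closure of $\mathbb{Q}_p$, and $q\in\mathbb{C}_p$ with $|1-q|_p<1$ (then also $|1-q^{-1}|_p<1$). Put $[2]_q=1+q$. For $Q\in\{q,q^{-1}\}$ the $Q$-Euler numbers $\xi_{n,Q}$ are defined by $\xi_{0,Q}=1$ and, for $n\ge 1$, $Q\sum_{l=0}^{n}\binom{n}{l}Q^l\xi_{l,Q}+\xi_{n,Q}=0$; $\xi_{n,1/q}$ denotes these numbers for $Q=q^{-1}$. *)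

theory Defs
  imports Complex_Main
    "HOL-Computational_Algebra.Primes"
    "HOL-Computational_Algebra.Polynomial"
begin

text \<open>
  The type of \<open>p\<close>-adic complex numbers would depend on the number \<open>p\<close>, so \<open>\<complex>\<^sub>p\<close> is rendered as an
  arbitrary field with an absolute value that is a completion of an algebraic closure of
  \<open>\<rat>\<^sub>p\<close>, the latter being a completion of \<open>\<rat>\<close> for the \<open>p\<close>-adic absolute value. This determines
  \<open>\<complex>\<^sub>p\<close> up to isometric isomorphism.
\<close>

definition padic_abs_rat :: "nat \<Rightarrow> rat \<Rightarrow> real" where
  "padic_abs_rat p r =
     (if r = 0 then 0
      else case quotient_of r of (a, b) \<Rightarrow>
        real p powi (int (multiplicity (int p) b) - int (multiplicity (int p) a)))"

definition nonarch_abs :: "('a::field \<Rightarrow> real) \<Rightarrow> bool" where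
  "nonarch_abs av \<longleftrightarrow>
     (\<forall>x. av x \<ge> 0) \<and> (\<forall>x. av x = 0 \<longleftrightarrow> x = 0) \<and>
     (\<forall>x y. av (x * y) = av x * av y) \<and> (\<forall>x y. av (x + y) \<le> max (av x) (av y))"

definition subfield_set :: "'a::field set \<Rightarrow> bool" where
  "subfield_set K \<longleftrightarrow>
     0 \<in> K \<and> 1 \<in> K \<and> (\<forall>x\<in>K. \<forall>y\<in>K. x - y \<in> K \<and> x * y \<in> K) \<and> (\<forall>x\<in>K. inverse x \<in> K)"

definition complete_wrt :: "('a::field \<Rightarrow> real) \<Rightarrow> 'a set \<Rightarrow> bool" where
  "complete_wrt av K \<longleftrightarrow>
     (\<forall>X :: nat \<Rightarrow> 'a.
        (\<forall>n. X n \<in> K) \<and> (\<forall>e>0. \<exists>M. \<forall>m\<ge>M. \<forall>n\<ge>M. av (X m - X n) < e)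
        \<longrightarrow> (\<exists>L\<in>K. (\<lambda>n. av (X n - L)) \<longlonglongrightarrow> 0))"

definition completion_of :: "('a::field \<Rightarrow> real) \<Rightarrow> 'a set \<Rightarrow> 'a set \<Rightarrow> bool" where
  "completion_of av A K \<longleftrightarrow>
     subfield_set K \<and> A \<subseteq> K \<and> (\<forall>x\<in>K. \<forall>e>0. \<exists>a\<in>A. av (x - a) < e) \<and> complete_wrt av K"

definition algebraic_closure_of :: "'a::field set \<Rightarrow> 'a set \<Rightarrow> bool" where
  "algebraic_closure_of F K \<longleftrightarrow>
     subfield_set K \<and> F \<subseteq> K \<and>
     (\<forall>x\<in>K. \<exists>P. P \<noteq> 0 \<and> (\<forall>i. coeff P i \<in> F) \<and> poly P x = 0) \<and>
     (\<forall>P. (\<forall>i. coeff P i \<in> K) \<and> degree P > 0 \<longrightarrow> (\<exists>x\<in>K. poly P x = 0))"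

locale padic_complex_field =
  fixes p :: nat and av :: "'a::field_char_0 \<Rightarrow> real"
  assumes prime_p: "prime p"
    and nonarch: "nonarch_abs av"
    and av_of_rat: "av (of_rat r) = padic_abs_rat p r"
    and completion_of_algebraic_closure:
      "\<exists>Qp Qp_alg. completion_of av \<rat> Qp \<and> algebraic_closure_of Qp Qp_alg
         \<and> completion_of av Qp_alg UNIV"

definition is_q_Euler_seq :: "'a::field \<Rightarrow> (nat \<Rightarrow> 'a) \<Rightarrow> bool" where
  "is_q_Euler_seq Q f \<longleftrightarrow>
     f 0 = 1 \<and>
     (\<forall>n\<ge>1. Q * (\<Sum>l=0..n. of_nat (n choose l) * Q ^ l * f l) + f n = 0)"

definition q_Euler :: "'a::field \<Rightarrow> nat \<Rightarrow> 'a" where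
  "q_Euler Q = (THE f. is_q_Euler_seq Q f)"

text \<open>
  The recurrence has exactly one solution whenever no \<open>1 + Q\<^bsup>n+1\<^esup>\<close> with \<open>n \<ge> 1\<close> vanishes, in particular
  for odd \<open>p\<close> and \<open>|1 - Q|\<^sub>p < 1\<close>.
\<close>

fun q_Euler_rec :: "'a::field \<Rightarrow> nat \<Rightarrow> 'a" where
  "q_Euler_rec Q n =
     (if n = 0 then 1
      else - (Q * (\<Sum>l\<in>{0..<n}. of_nat (n choose l) * Q ^ l * q_Euler_rec Q l))
             / (1 + Q ^ (n + 1)))"

declare q_Euler_rec.simps [simp del]

lemma q_Euler_step:
  fixes Q :: "'a::field"
  assumes "1 + Q ^ (n + 1) \<noteq> 0"
  shows "Q * (\<Sum>l=0..n. of_nat (n choose l) * Q ^ l * f l) + f n = 0 \<longleftrightarrow>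
    f n = - (Q * (\<Sum>l\<in>{0..<n}. of_nat (n choose l) * Q ^ l * f l)) / (1 + Q ^ (n + 1))"
proof -
  define S where "S = (\<Sum>l\<in>{0..<n}. of_nat (n choose l) * Q ^ l * f l)"
  have "(\<Sum>l=0..n. of_nat (n choose l) * Q ^ l * f l) = S + Q ^ n * f n"
    unfolding S_def by (simp add: atLeastLessThanSuc_atLeastAtMost[symmetric])
  then have "Q * (\<Sum>l=0..n. of_nat (n choose l) * Q ^ l * f l) + f n = Q * S + f n * (1 + Q ^ (n + 1))"
    by (simp add: algebra_simps)
  moreover have "Q * S + f n * (1 + Q ^ (n + 1)) = 0 \<longleftrightarrow> f n = - (Q * S) / (1 + Q ^ (n + 1))"
    using assms
    by (metis add.commute add_eq_0_iff2 nonzero_eq_divide_eq)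
  ultimately show ?thesis
    unfolding S_def by simp
qed

lemma is_q_Euler_seq_ex1:
  fixes Q :: "'a::field"
  assumes nz: "\<And>n. n \<ge> 1 \<Longrightarrow> 1 + Q ^ (n + 1) \<noteq> 0"
  shows "\<exists>!f. is_q_Euler_seq Q f"
proof (rule ex1I)
  show "is_q_Euler_seq Q (q_Euler_rec Q)"
    unfolding is_q_Euler_seq_def
  proof (intro conjI allI impI)
    show "q_Euler_rec Q 0 = 1"
      by (simp add: q_Euler_rec.simps)
  next
    fix n :: nat
    assume n: "n \<ge> 1"
    have "q_Euler_rec Q n =
      - (Q * (\<Sum>l\<in>{0..<n}. of_nat (n choose l) * Q ^ l * q_Euler_rec Q l)) / (1 + Q ^ (n + 1))"
      using n by (subst q_Euler_rec.simps) simp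
    then show "Q * (\<Sum>l=0..n. of_nat (n choose l) * Q ^ l * q_Euler_rec Q l) + q_Euler_rec Q n = 0"
      using q_Euler_step[of Q n "q_Euler_rec Q"] nz[OF n] by blast
  qed
next
  fix f
  assume f: "is_q_Euler_seq Q f"
  have "f n = q_Euler_rec Q n" for n
  proof (induction n rule: less_induct)
    case (less n)
    show ?case
    proof (cases "n = 0")
      case True
      with f show ?thesis
        by (simp add: is_q_Euler_seq_def q_Euler_rec.simps)
    next
      case False
      then have n: "n \<ge> 1" by simp
      have "Q * (\<Sum>l=0..n. of_nat (n choose l) * Q ^ l * f l) + f n = 0"
        using f n unfolding is_q_Euler_seq_def by blast
      then have "f n = - (Q * (\<Sum>l\<in>{0..<n}. of_nat (n choose l) * Q ^ l * f l)) / (1 + Q ^ (n + 1))"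
        using q_Euler_step[of Q n f] nz[OF n] by blast
      also have "\<dots> = q_Euler_rec Q n"
        using False less.IH by (subst q_Euler_rec.simps) simp
      finally show ?thesis .
    qed
  qed
  then show "f = q_Euler_rec Q" by blast
qed

context padic_complex_field
begin

lemma av_mult: "av (x * y) = av x * av y"
  and av_add: "av (x + y) \<le> max (av x) (av y)"
  and av_nonneg: "av x \<ge> 0"
  and av_eq_0: "av x = 0 \<longleftrightarrow> x = 0"
  using nonarch unfolding nonarch_abs_def by blast+

lemma av_1: "av 1 = 1"
  using av_mult[of 1 1] av_eq_0[of 1] by simp

lemma av_minus: "av (- x) = av x"
proof -
  have "av (- 1) * av (- 1) = 1"
    using av_mult[of "-1" "-1"] av_1 by simp
  then have "av (- 1) = 1"
    using av_nonneg[of "-1"] by (metis abs_of_nonneg abs_mult_self_eq power2_eq_1_iff power2_eq_square zero_neq_one abs_1 abs_minus_cancel)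
  then show ?thesis
    using av_mult[of "-1" x] by simp
qed

lemma av_eq_1:
  assumes "av (1 - Q) < 1"
  shows "av Q = 1"
proof -
  have "av Q \<le> 1"
    using av_add[of 1 "- (1 - Q)"] av_minus[of "1 - Q"] av_1 assms by simp
  moreover have "av Q \<ge> 1"
    using av_add[of Q "1 - Q"] av_1 assms by simp
  ultimately show ?thesis by simp
qed

lemma av_1_minus_power:
  assumes "av (1 - Q) < 1"
  shows "av (1 - Q ^ n) < 1"
proof (induction n)
  case 0
  have "av 0 = 0" using av_eq_0 by blast
  then show ?case by simp
next
  case (Suc n)
  have "1 - Q ^ Suc n = (1 - Q) + Q * (1 - Q ^ n)"
    by (simp add: algebra_simps)
  then have "av (1 - Q ^ Suc n) \<le> max (av (1 - Q)) (av Q * av (1 - Q ^ n))"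
    using av_add av_mult by metis
  then show ?case
    using assms av_eq_1[OF assms] Suc by simp
qed

lemma av_1_minus_inverse:
  assumes "av (1 - Q) < 1"
  shows "av (1 - inverse Q) < 1"
proof -
  have Q: "Q \<noteq> 0" "av Q = 1"
    using av_eq_1[OF assms] av_eq_0[of Q] by auto
  have "Q * (1 - inverse Q) = - (1 - Q)"
    using Q by (simp add: algebra_simps)
  then have "av Q * av (1 - inverse Q) = av (1 - Q)"
    by (metis av_mult av_minus)
  then show ?thesis
    using Q assms by simp
qed

lemma av_2:
  assumes "odd p"
  shows "av 2 = 1"
proof -
  have "\<not> int p dvd 2"
  proof
    assume "int p dvd 2"
    then have "p dvd 2"
      by presburger
    then have "p = 2"
      using prime_p primes_dvd_imp_eq two_is_prime_nat by blast
    then show False using assms by simp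
  qed
  then have "multiplicity (int p) 2 = 0"
    by (rule not_dvd_imp_multiplicity_0)
  moreover have "quotient_of 2 = (2, 1)"
    by simp
  ultimately have "padic_abs_rat p 2 = 1"
    by (simp add: padic_abs_rat_def)
  then show ?thesis
    using av_of_rat[of 2] by simp
qed

lemma one_plus_power_nonzero:
  assumes "odd p" and "av (1 - Q) < 1"
  shows "1 + Q ^ n \<noteq> 0"
proof
  assume "1 + Q ^ n = 0"
  then have "1 - Q ^ n = 2"
    by (metis add.commute add_eq_0_iff diff_minus_eq_add one_add_one)
  then show False
    using av_1_minus_power[OF assms(2), of n] av_2[OF assms(1)] by (metis less_irrefl)
qed

lemma q_Euler_seq:
  assumes "odd p" and "av (1 - Q) < 1"
  shows "is_q_Euler_seq Q (q_Euler Q)"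
proof -
  have "\<exists>!f. is_q_Euler_seq Q f"
    by (rule is_q_Euler_seq_ex1) (rule one_plus_power_nonzero[OF assms])
  from theI'[OF this] show ?thesis
    unfolding q_Euler_def .
qed

end

end

theory Submission
  imports Defs
begin

text \<open>
  Let \<open>L\<^sub>Q\<close> be the linear functional on polynomials with \<open>L\<^sub>Q(x\<^sup>n) = \<xi>\<^sub>n\<^sub>,\<^sub>Q\<close>. The recurrence says
  \<open>Q L\<^sub>Q(P(1 + Q x)) + L\<^sub>Q(P) = (1 + Q) P(0)\<close> for all \<open>P\<close>, and it determines \<open>L\<^sub>Q\<close>. The functional
  \<open>P \<mapsto> q\<^sup>-\<^sup>2 (L\<^sub>q(P(1 - x)) - (1 + q) (P(1) - q P(0)))\<close> satisfies this equation for \<open>Q = 1/q\<close>, so that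
  \<open>L\<^sub>q(P(1 - x)) = q\<^sup>2 L\<^sub>1\<^sub>/\<^sub>q(P) + (1 + q) (P(1) - q P(0))\<close>. Both identities are this reflection formula
  for \<open>P = x\<^bsup>N-sk\<^esup> (1 - x)\<^bsup>sk\<^esup>\<close>; the boundary terms vanish if \<open>k > 0\<close>.
\<close>

definition moment_functional :: "(nat \<Rightarrow> 'a::field) \<Rightarrow> 'a poly \<Rightarrow> 'a" where
  "moment_functional f P = (\<Sum>i\<le>degree P. coeff P i * f i)"

lemma moment_functional_eq_sum:
  assumes "degree P \<le> n"
  shows "moment_functional f P = (\<Sum>i\<le>n. coeff P i * f i)"
  unfolding moment_functional_def
  by (rule sum.mono_neutral_left) (use assms in \<open>auto simp: coeff_eq_0\<close>)

lemma moment_functional_add: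
  "moment_functional f (P + R) = moment_functional f P + moment_functional f R"
proof -
  let ?n = "max (degree P) (degree R)"
  have "degree (P + R) \<le> ?n"
    by (rule degree_add_le_max)
  then show ?thesis
    by (simp add: moment_functional_eq_sum[of _ ?n] sum.distrib algebra_simps)
qed

lemma moment_functional_smult:
  "moment_functional f (smult c P) = c * moment_functional f P"
  by (simp add: moment_functional_eq_sum[of _ "degree P"] sum_distrib_left mult.assoc)

lemma moment_functional_monom: "moment_functional f (monom c n) = c * f n"
proof -
  have "moment_functional f (monom c n) = (\<Sum>i\<le>n. if i = n then c * f n else 0)"
    unfolding moment_functional_eq_sum[OF degree_monom_le]
    by (rule sum.cong) auto
  then show ?thesis by simp
qed

lemma moment_functional_1: "moment_functional f 1 = f 0"
  by (simp add: moment_functional_def)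

lemma moment_functional_sum_monom:
  "finite A \<Longrightarrow>
    moment_functional f (\<Sum>l\<in>A. monom (c l) (e l)) = (\<Sum>l\<in>A. c l * f (e l))"
proof (induction A rule: finite_induct)
  case empty
  show ?case by (simp add: moment_functional_def)
qed (simp add: moment_functional_add moment_functional_monom)

text \<open>Monomials span the polynomials. This reduces both the functional equation and the
  reflection formula to powers of x.\<close>

lemma poly_linear_eqI:
  fixes A B :: "'a::comm_ring_1 poly \<Rightarrow> 'a"
  assumes "\<And>P R. A (P + R) = A P + A R" and "\<And>c P. A (smult c P) = c * A P"
    and "\<And>P R. B (P + R) = B P + B R" and "\<And>c P. B (smult c P) = c * B P"
    and "\<And>n. A (monom 1 n) = B (monom 1 n)"
  shows "A P = B P"
proof -
  have 0: "A 0 = 0" "B 0 = 0"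
    using assms(2)[of 0 0] assms(4)[of 0 0] by simp_all
  have "A (\<Sum>i\<in>S. smult (c i) (monom 1 i)) = B (\<Sum>i\<in>S. smult (c i) (monom 1 i))"
    if "finite S" for S c
    using that by (induction S rule: finite_induct) (simp_all add: 0 assms)
  from this[of "{..degree P}" "coeff P"] show ?thesis
    by (simp add: smult_monom poly_as_sum_of_monoms)
qed

lemma pcompose_monom_one: "pcompose (monom 1 n) R = R ^ n"
  for R :: "'a::comm_ring_1 poly"
  by (induction n) (simp_all add: monom_Suc pcompose_pCons pcompose_1)

lemma pcompose_power: "pcompose (P ^ n) R = pcompose P R ^ n"
  for R :: "'a::comm_ring_1 poly"
  by (induction n) (simp_all add: pcompose_mult pcompose_1)

lemma linear_poly_power_eq_sum:
  "[:1, c:] ^ n = (\<Sum>l\<le>n. monom (of_nat (n choose l) * c ^ l) l)"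
  for c :: "'a::comm_ring_1"
proof -
  have "[:1, c:] = monom c 1 + 1"
    by (simp add: monom_altdef one_pCons)
  then show ?thesis
    by (simp add: binomial_ring monom_power mult_monom of_nat_monom smult_monom)
qed

text \<open>Both sides are linear in \<open>P\<close>. At x^n with n \<ge> 1 the claim is the
  recurrence itself; at n = 0 it reads \<open>Q * f 0 + f 0 = 1 + Q\<close>, which is the
  normalisation \<open>f 0 = 1\<close>.\<close>

lemma q_Euler_functional_equation:
  assumes "is_q_Euler_seq Q f"
  shows "Q * moment_functional f (pcompose P [:1, Q:]) + moment_functional f P = (1 + Q) * poly P 0"
proof (rule poly_linear_eqI[where P = P])
  fix n
  have *: "moment_functional f (pcompose (monom 1 n) [:1, Q:])
      = (\<Sum>l=0..n. of_nat (n choose l) * Q ^ l * f l)"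
    by (simp add: pcompose_monom_one linear_poly_power_eq_sum moment_functional_sum_monom
        atLeast0AtMost)
  show "Q * moment_functional f (pcompose (monom 1 n) [:1, Q:]) + moment_functional f (monom 1 n)
      = (1 + Q) * poly (monom 1 n) 0"
    using assms unfolding * is_q_Euler_seq_def
    by (cases "n = 0") (auto simp: moment_functional_monom moment_functional_1 poly_monom)
qed (simp_all add: pcompose_add pcompose_smult moment_functional_add moment_functional_smult
    algebra_simps)

text \<open>The candidate comes from solving the reflection formula at x^n for the 1/q-side;
  \<open>0 ^ n\<close> is the value of x^n at 0, hence 1 for n = 0.\<close>

lemma is_q_Euler_seq_reflection:
  fixes q :: "'a::field"
  assumes f: "is_q_Euler_seq q f" and q: "q \<noteq> 0"
  shows "is_q_Euler_seq (inverse q)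
    (\<lambda>n. (moment_functional f ([:1, -1:] ^ n) - (1 + q) * (1 - q * 0 ^ n)) / q ^ 2)"
    (is "is_q_Euler_seq _ ?g")
  unfolding is_q_Euler_seq_def
proof (intro conjI allI impI)
  show "?g 0 = 1"
    using f q by (simp add: is_q_Euler_seq_def moment_functional_1 field_simps power2_eq_square)
next
  fix n :: nat
  assume n: "n \<ge> 1"
  define r where "r = inverse q"
  have qr: "q * r = 1" "r * q = 1" using q by (simp_all add: r_def)
  let ?M = "\<lambda>P. moment_functional f (pcompose P [:1, -1:])"
  \<comment> \<open>\<open>?G\<close> extends \<open>?g\<close> linearly from monomials to
    polynomials, so the binomial sum in the recurrence becomes one value of
    \<open>?G\<close>.\<close>
  let ?G = "\<lambda>P. (?M P - (1 + q) * (poly P 1 - q * poly P 0)) / q ^ 2"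
  have g: "?g l = ?G (monom 1 l)" for l
    by (simp add: pcompose_monom_one poly_monom)
  let ?P = "pcompose (monom 1 n) [:1, r:]"
  have P: "?P = (\<Sum>l\<le>n. smult (of_nat (n choose l) * r ^ l) (monom 1 l))"
    by (simp add: pcompose_monom_one linear_poly_power_eq_sum smult_monom)
  have Gsum: "?G (\<Sum>l\<in>A. smult (c l) (R l)) = (\<Sum>l\<in>A. c l * ?G (R l))"
    if "finite A" for A :: "nat set" and c R
    using that
  proof (induction A rule: finite_induct)
    case empty
    show ?case by (simp add: moment_functional_def)
  next
    case (insert x A)
    then show ?case
      by (simp add: pcompose_add pcompose_smult moment_functional_add moment_functional_smult
          diff_divide_distrib add_divide_distrib algebra_simps)
  qed
  have sum: "(\<Sum>l=0..n. of_nat (n choose l) * r ^ l * ?g l) = ?G ?P"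
    unfolding g P by (subst Gsum) (simp_all add: atLeast0AtMost)
  let ?H = "pcompose ?P [:1, -1:]"
  \<comment> \<open>Since \<open>q * r = 1\<close>, substituting 1 + q x into 1 + r (1 - x) gives 1
    - x. So the equation for \<open>f\<close> at \<open>?H\<close> relates exactly the two moments
    that the recurrence for \<open>r\<close> involves.\<close>
  have "pcompose ?H [:1, q:] = pcompose (monom 1 n) [:1, -1:]"
    by (simp add: pcompose_monom_one pcompose_power pcompose_pCons qr)
  moreover have "poly ?H 0 = (1 + r) ^ n"
    by (simp add: poly_pcompose poly_monom)
  ultimately have fe: "q * ?M (monom 1 n) + ?M ?P = (1 + q) * (1 + r) ^ n"
    using q_Euler_functional_equation[OF f, of ?H] by simp
  \<comment> \<open>\<open>?P\<close> is 1 at 0 and x^n is 0 at 0, as n \<ge> 1; by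
    \<open>r * q = 1\<close> the two constants 1 + q cancel.\<close>
  have "r * ?G ?P + ?G (monom 1 n) =
     (r * (q * ?M (monom 1 n) + ?M ?P) - (1 + q) * (r * (1 + r) ^ n)) / q ^ 2"
    using n q by (simp add: poly_pcompose poly_monom field_simps r_def zero_power)
  also have "\<dots> = 0"
    unfolding fe by simp
  finally show "inverse q * (\<Sum>l=0..n. of_nat (n choose l) * inverse q ^ l * ?g l) + ?g n = 0"
    using sum unfolding g[symmetric] r_def by simp
qed

text \<open>By \<open>nz\<close> the recurrence for \<open>inverse q\<close> has only one solution,
  so \<open>g\<close> is the reflected sequence; linearity extends this from monomials to all
  \<open>P\<close>.\<close>

lemma q_Euler_reflection:
  fixes q :: "'a::field"
  assumes f: "is_q_Euler_seq q f" and g: "is_q_Euler_seq (inverse q) g" and q: "q \<noteq> 0"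
    and nz: "\<And>n. n \<ge> 1 \<Longrightarrow> 1 + inverse q ^ (n + 1) \<noteq> 0"
  shows "moment_functional f (pcompose P [:1, -1:])
    = q ^ 2 * moment_functional g P + (1 + q) * (poly P 1 - q * poly P 0)"
proof (rule poly_linear_eqI[where P = P])
  fix n
  have unique: "\<exists>!h. is_q_Euler_seq (inverse q) h"
    by (rule is_q_Euler_seq_ex1) (fact nz)
  note the_q_Euler = the1_equality[where P = "is_q_Euler_seq (inverse q)", OF unique]
  have "g = (\<lambda>n. (moment_functional f ([:1, -1:] ^ n) - (1 + q) * (1 - q * 0 ^ n)) / q ^ 2)"
    by (rule trans[OF the_q_Euler[OF g, symmetric] the_q_Euler[OF is_q_Euler_seq_reflection[OF f q]]])
  then have "g n = (moment_functional f ([:1, -1:] ^ n) - (1 + q) * (1 - q * 0 ^ n)) / q ^ 2"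
    by (rule fun_cong)
  then show "moment_functional f (pcompose (monom 1 n) [:1, -1:])
    = q ^ 2 * moment_functional g (monom 1 n)
      + (1 + q) * (poly (monom 1 n) 1 - q * poly (monom 1 n) 0)"
    using q by (simp add: pcompose_monom_one poly_monom moment_functional_monom)
qed (simp_all add: pcompose_add pcompose_smult moment_functional_add moment_functional_smult
    algebra_simps)

theorem theorem9:
  fixes p s k N :: nat and n :: "nat \<Rightarrow> nat"
    and av :: "'a::field_char_0 \<Rightarrow> real" and q :: 'a
  assumes "prime p" and "odd p"
    and "padic_complex_field p av"
    and "av (1 - q) < 1"
    and "s > 0"
    and "N = (\<Sum>i=1..s. n i)"
    and "N > s * k"
  shows "(k > 0 \<longrightarrow>
      (\<Sum>l=0..N - s * k. of_nat ((N - s * k) choose l) * (-1) ^ l * q_Euler q (l + s * k)) =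
      q ^ 2 * (\<Sum>l=0..s * k. of_nat ((s * k) choose l) * (-1) ^ (s * k - l)
        * q_Euler (inverse q) (N - l)))
    \<and> (k = 0 \<longrightarrow>
      (\<Sum>l=0..N. of_nat (N choose l) * (-1) ^ l * q_Euler q l) =
      (1 + q) + q ^ 2 * q_Euler (inverse q) N)"
proof -
  interpret padic_complex_field p av by fact
  let ?f = "q_Euler q" and ?g = "q_Euler (inverse q)"
  let ?m = "s * k" and ?d = "N - s * k"
  have inv: "av (1 - inverse q) < 1"
    by (rule av_1_minus_inverse) fact
  have q: "q \<noteq> 0"
    using av_eq_1[OF assms(4)] av_eq_0[of q] by auto
  have d: "?d > 0" "?d + ?m = N"
    using assms(7) by auto
  define P :: "'a poly" where "P = [:1, -1:] ^ ?m * monom 1 ?d"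
  \<comment> \<open>The substitution of 1 - x for x swaps the factors x and 1 - x.\<close>
  have "pcompose P [:1, -1:] = [:1, -1:] ^ ?d * monom 1 ?m"
    by (simp add: P_def pcompose_mult pcompose_power pcompose_pCons pcompose_monom_one monom_altdef)
  also have "\<dots> = (\<Sum>l\<le>?d. monom (of_nat (?d choose l) * (-1) ^ l) (l + ?m))"
    by (simp add: linear_poly_power_eq_sum sum_distrib_right mult_monom)
  finally have lhs: "moment_functional ?f (pcompose P [:1, -1:])
      = (\<Sum>l=0..?d. of_nat (?d choose l) * (-1) ^ l * ?f (l + ?m))"
    by (simp add: moment_functional_sum_monom atLeast0AtMost)
  have "P = (\<Sum>l\<le>?m. monom (of_nat (?m choose l) * (-1) ^ l) (l + ?d))"
    by (simp add: P_def linear_poly_power_eq_sum sum_distrib_right mult_monom)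
  then have "moment_functional ?g P = (\<Sum>l\<le>?m. of_nat (?m choose l) * (-1) ^ l * ?g (l + ?d))"
    by (simp add: moment_functional_sum_monom)
  \<comment> \<open>Reversing the summation turns the index \<open>l + ?d\<close> into
    \<open>N - l\<close>.\<close>
  also have "\<dots> = (\<Sum>l=0..?m. of_nat (?m choose l) * (-1) ^ (?m - l) * ?g (N - l))"
    unfolding atLeast0AtMost
    by (rule sum.reindex_bij_witness[of _ "\<lambda>l. ?m - l" "\<lambda>l. ?m - l"])
      (use d in \<open>auto simp: binomial_symmetric[symmetric] add.commute\<close>)
  finally have rhs: "moment_functional ?g P
      = (\<Sum>l=0..?m. of_nat (?m choose l) * (-1) ^ (?m - l) * ?g (N - l))" .
  have refl: "moment_functional ?f (pcompose P [:1, -1:])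
      = q ^ 2 * moment_functional ?g P + (1 + q) * (poly P 1 - q * poly P 0)"
    by (intro q_Euler_reflection q_Euler_seq one_plus_power_nonzero assms inv q)
  \<comment> \<open>The two cases separate here: \<open>0 ^ ?m\<close> is 0 if k > 0 (as s > 0) and
    1 if k = 0, which leaves the extra term 1 + q.\<close>
  have "poly P 0 = 0" "poly P 1 = 0 ^ ?m"
    using d by (simp_all add: P_def poly_monom)
  with refl[unfolded lhs rhs] assms(5) show ?thesis
    by auto
qed

end
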